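(* Let $M,K,\rho_c,\alpha_1,\alpha_2$ satisfy the discrete-time robust control contraction metric condition (RCCM), let $\ell(\bar x,\bar u,\delta)=\|\bar x\|_Q^2+\|\bar u\|_R^2+\lambda\delta^2$ with $Q\in\mathbb S_+^{n_x}$, $R\in\mathbb S_+^{n_u}$, $\lambda>0$, and let $$c_j=\max_{(x,u)\in\mathcal Z}\left\|\left(\frac{\partial h_j}{\partial x}(x,u)+\frac{\partial h_j}{\partial u}(x,u)K(x)\right)M(x)^{-1/2}\right\|,\quad j=1,\dots,n_h.$$ Set $k_f(\bar x)\equiv 0_{n_u}$, $\ell_f(\bar x,\delta)=\frac{\lambda}{\rho_c}\delta^2$ and $$\mathcal X_f=\{(\bar x,\delta)\in\mathbb R^{n_x}\times\mathbb R_{\ge0}\mid \bar x=0_{n_x},\ h_j(\bar x,k_f(\bar x))+c_j\delta\le0\ \ \forall j\in\{1,\dots,n_h\}\}.$$ Then for any $(\bar x,\delta)\in\mathcal X_f$ and all $j\in\{1,\dots,n_h\}$, with $\bar x_+=\hat F(\bar x,k_f(\bar x))$ and $\delta_+=\sqrt{1-\rho_c}\,\delta+\sqrt{\alpha_2}\,(c_x\|\hat\Phi(\bar x)\|+c_u\|k_f(\bar x)\|)$, the following hold: (a) $(\bar x_+,\delta_+)\in\mathcal X_f$; (b) $h_j(\bar x,k_f(\bar x))+c_j\delta\le0$ and $h_j(\bar x_+,k_f(\bar x_+))+c_j\delta_+\le0$; (c) $\ell(\bar x,k_f(\bar x),\delta)\le\ell_f(\bar x,\delta)-\ell_f(\bar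 x_+,\delta_+)$; (d) for every $\hat\delta\in[0,\delta]$, $(\bar x,\hat\delta)\in\mathcal X_f$ and $\ell_f(\bar x,\hat\delta)\le\ell_f(\bar x,\delta)$.
   Context: Notation: $\|\cdot\|$ is the Euclidean norm, $\|y\|_P=\sqrt{y^\top P y}$, $\mathcal B(y,r)$ is the closed ball, $\otimes$ the Kronecker product, $\preceq$ the Loewner order, $\mathbb S_+^n$ the symmetric positive definite $n\times n$ matrices, $\|\cdot\|_F$ the Frobenius norm; $P^{1/2}$ is the Cholesky factor with $P=(P^{1/2})^\top P^{1/2}$ and $P^{-1/2}$ its inverse. System. $\mathbb X\subset\mathbb R^{n_x}$ and $\mathbb U\subset\mathbb R^{n_u}$ are compact, and $\mathbb U$ contains the standard basis vectors $e_1,\dots,e_{n_u}$. The true system is $\dot x=f(x)+g(x)u$ with $f(0)=0$; $x(t;\hat x,u)$ is its solution at time $t$ from $\hat x$ under constant input $u$ (provided it exists), $T_s>0$ is fixed, and $F(x,u)=x(T_s;x,u)$ is the sampled true map. The constraint set $\mathcal Z=\{(x,u)\in\mathbb R^{n_x}\times\mathbb R^{n_u}\mid h_j(x,u)\le0,\ j=1,\dots,n_h\}\subseteq\mathbb X\times\mathbb U$ is compact, each $h_j$ is continuously differentiable and $h_j(0,0)<0$. Learned model. $\hat\Phi(x)=[x^\top\ \phi_{n_x+1}(x)\cdots\phi_{n_z}(x)]^\top\in\mathbb R^{n_z}$, $n_z>n_x$, with continuously differentiable $\phi_\ell:\mathbb R^{n_x}\to\mathbb R$, $\phi_\ell(0)=0$.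 From data $y_j^{\tilde u}=F(x_j^{\tilde u},\tilde u)$, $j=1,\dots,d$, $\tilde u\in\{0,e_1,\dots,e_{n_u}\}$, the matrices $A,B_i\in\mathbb R^{n_z\times n_z}$ and $b_i\in\mathbb R^{n_z}$ are least-squares fits: $A$ minimizes $\|[\hat\Phi(y_1^0)\cdots\hat\Phi(y_d^0)]-A[\hat\Phi(x_1^0)\cdots\hat\Phi(x_d^0)]\|_F$, and $[b_i\ B_i]$ minimizes $\|[\hat\Phi(y_1^{e_i})\cdots\hat\Phi(y_d^{e_i})]-[b_i\ B_i][\Phi(x_1^{e_i})\cdots\Phi(x_d^{e_i})]\|_F$ with $\Phi=[1\ \hat\Phi^\top]^\top$. Put $B_0=[b_1\cdots b_{n_u}]$, $\mathcal L(x,u)=A\hat\Phi(x)+B_0u+\sum_{i=1}^{n_u}(B_i-A)u_i\hat\Phi(x)$ and $\hat F(x,u)=[I_{n_x}\ 0_{n_x\times(n_z-n_x)}]\,\mathcal L(x,u)$. The numbers $c_x,c_u\ge0$ are the constants of the approximation-error bound $\|\hat\Phi(F(x,u))-\mathcal L(x,u)\|\le c_x\|\hat\Phi(x)\|+c_u\|u\|$. Uncertain predictor. $E(x,u)=[c_x(\hat\Phi(x)^\top\otimes I_{n_x})\ \ c_u(u^\top\otimes I_{n_x})]$; $\mathbb D$ is the set of vectors $\begin{bmatrix}w_\Phi\otimes w_x\\ w_u\otimes w_x\end{bmatrix}$ with $w_\Phi\in\mathcal B(0_{n_z},1)$, $w_u\in\mathcal B(0_{n_u},1)$, $w_x\in\mathcal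 B(0_{n_x},1)$; and $f_w(x,u,w)=\hat F(x,u)+E(x,u)w$. (RCCM): $M:\mathbb R^{n_x}\to\mathbb S_+^{n_x}$ is continuously differentiable, $K:\mathbb R^{n_x}\to\mathbb R^{n_u\times n_x}$ is continuous, $0<\rho_c<1$, $\alpha_1,\alpha_2>0$, and for all $(x,u)\in\mathcal Z$, $w\in\mathbb D$, with $x_+=f_w(x,u,w)$ and $A_{cl}(x,u,w)=\frac{\partial f_w}{\partial x}(x,u,w)+\frac{\partial f_w}{\partial u}(x,u,w)K(x)$: $A_{cl}^\top M(x_+)A_{cl}\preceq(1-\rho_c)M(x)$, $\alpha_1I\preceq M(x)\preceq\alpha_2I$, and $M(x_+)\preceq\alpha_2I$. *)

theory Defs
  imports "HOL-Analysis.Analysis"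
begin

text \<open>Stacked vectors and block rows are indexed by sum types, Kronecker products by product types.\<close>

definition vstack :: "real^'a \<Rightarrow> real^'b \<Rightarrow> real^('a + 'b)" where
  "vstack v w = (\<chi> s. case s of Inl i \<Rightarrow> v $ i | Inr j \<Rightarrow> w $ j)"

definition hcat :: "real^'a^'r \<Rightarrow> real^'b^'r \<Rightarrow> real^('a + 'b)^'r" where
  "hcat A B = (\<chi> r. vstack (A $ r) (B $ r))"

definition from_columns :: "('c \<Rightarrow> real^'r) \<Rightarrow> real^'c^'r" where
  "from_columns v = (\<chi> r c. v c $ r)"

definition kron_vec :: "real^'a \<Rightarrow> real^'b \<Rightarrow> real^('a \<times> 'b)" where
  "kron_vec v w = (\<chi> p. v $ fst p * w $ snd p)"

text \<open>The Kronecker product of the row vector with entries \<open>v\<close> and the matrix \<open>B\<close>.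
  Its row index type \<open>1 \<times> 'r\<close> is identified with \<open>'r\<close>.\<close>

definition kron_row :: "real^'a \<Rightarrow> real^'b^'r \<Rightarrow> real^('a \<times> 'b)^'r" where
  "kron_row v B = (\<chi> r p. v $ fst p * B $ r $ snd p)"

definition spd :: "(real^'n^'n) set" where
  "spd = {P. transpose P = P \<and> (\<forall>v. v \<noteq> 0 \<longrightarrow> 0 < v \<bullet> (P *v v))}"

definition loewner_le :: "real^'n^'n \<Rightarrow> real^'n^'n \<Rightarrow> bool" (infix "\<preceq>\<^sub>L" 50) where
  "P \<preceq>\<^sub>L Q \<longleftrightarrow> transpose (Q - P) = Q - P \<and> (\<forall>v. 0 \<le> v \<bullet> ((Q - P) *v v))"

definition wnorm :: "real^'n^'n \<Rightarrow> real^'n \<Rightarrow> real" where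
  "wnorm P y = sqrt (y \<bullet> (P *v y))"

text \<open>A positive definite matrix has exactly one factor of this form (upper triangular, with
  positive diagonal), so the choice operator selects it.\<close>

definition cholesky :: "real^'n::{finite,linorder}^'n::_ \<Rightarrow> real^'n::_^'n::_" where
  "cholesky P = (SOME U. (\<forall>i j. j < i \<longrightarrow> U $ i $ j = 0) \<and> (\<forall>i. 0 < U $ i $ i)
                       \<and> P = transpose U ** U)"

definition cont_diff :: "('a::real_normed_vector \<Rightarrow> 'b::real_normed_vector) \<Rightarrow> bool" where
  "cont_diff f \<longleftrightarrow> (\<exists>f'. (\<forall>x. (f has_derivative blinfun_apply (f' x)) (at x)) \<and> continuous_on UNIV f')"

text \<open>Derivatives of scalar functions are row vectors; they are represented by elements of
  \<open>real^'n\<close> that act on matrices from the left via \<open>(v*)\<close>.\<close>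

definition row_deriv :: "(real^'n \<Rightarrow> real) \<Rightarrow> real^'n \<Rightarrow> real^'n" where
  "row_deriv f x = (\<chi> i. frechet_derivative f (at x) (axis i 1))"

text \<open>\<open>p\<close> is the value at time \<open>t\<close> of a solution of \<open>x' = f x + g x u\<close> on \<open>{0..t}\<close> that
  starts in \<open>x0\<close>, for the constant input \<open>u\<close>.\<close>

definition reaches ::
  "(real^'n \<Rightarrow> real^'n) \<Rightarrow> (real^'n \<Rightarrow> real^'m^'n) \<Rightarrow> real \<Rightarrow> real^'n \<Rightarrow> real^'m \<Rightarrow> real^'n \<Rightarrow> bool" where
  "reaches f g t x0 u p \<longleftrightarrow>
     (\<exists>\<xi>. \<xi> 0 = x0 \<and>
          (\<forall>s\<in>{0..t}. (\<xi> has_vector_derivative (f (\<xi> s) + g (\<xi> s) *v u)) (at s within {0..t})) \<and>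
          \<xi> t = p)"

definition flow_defined ::
  "(real^'n \<Rightarrow> real^'n) \<Rightarrow> (real^'n \<Rightarrow> real^'m^'n) \<Rightarrow> real \<Rightarrow> real^'n \<Rightarrow> real^'m \<Rightarrow> bool" where
  "flow_defined f g t x0 u \<longleftrightarrow> (\<exists>!p. reaches f g t x0 u p)"

text \<open>Meaningful only if \<open>flow_defined f g t x0 u\<close>; for \<open>t\<close> the sampling period this is the
  sampled map.\<close>

definition flow ::
  "(real^'n \<Rightarrow> real^'n) \<Rightarrow> (real^'n \<Rightarrow> real^'m^'n) \<Rightarrow> real \<Rightarrow> real^'n \<Rightarrow> real^'m \<Rightarrow> real^'n" where
  "flow f g t x0 u = (THE p. reaches f g t x0 u p)"

definition constraint_set ::
  "nat \<Rightarrow> (nat \<Rightarrow> (real^'n) \<times> (real^'m) \<Rightarrow> real) \<Rightarrow> ((real^'n) \<times> (real^'m)) set" where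
  "constraint_set nh h = {z. \<forall>j\<in>{1..nh}. h j z \<le> 0}"

text \<open>The lifted space is \<open>real^('n + 'k)\<close>, where \<open>'k\<close> indexes the observables beyond the state;
  as \<open>'k\<close> is nonempty, the lifted dimension exceeds the state dimension.\<close>

definition lift :: "('k::finite \<Rightarrow> real^'n \<Rightarrow> real) \<Rightarrow> real^'n \<Rightarrow> real^('n + 'k)" where
  "lift \<phi> x = vstack x (\<chi> l. \<phi> l x)"

definition lift1 :: "('k::finite \<Rightarrow> real^'n \<Rightarrow> real) \<Rightarrow> real^'n \<Rightarrow> real^(1 + ('n + 'k))" where
  "lift1 \<phi> x = vstack (vec 1) (lift \<phi> x)"

text \<open>The norm of \<open>real^'a^'b\<close> is the Frobenius norm.\<close>

definition least_squares_fit :: "real^'a^'b \<Rightarrow> real^'d^'b \<Rightarrow> real^'d^'a \<Rightarrow> bool" where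
  "least_squares_fit G Y X \<longleftrightarrow> (\<forall>G'. norm (Y - G ** X) \<le> norm (Y - G' ** X))"

definition lifted_model ::
  "real^('n + 'k::finite)^('n + 'k) \<Rightarrow> ('m::finite \<Rightarrow> real^('n + 'k)^('n + 'k)) \<Rightarrow> ('m \<Rightarrow> real^('n + 'k)) \<Rightarrow>
   ('k \<Rightarrow> real^'n \<Rightarrow> real) \<Rightarrow> real^'n \<Rightarrow> real^'m \<Rightarrow> real^('n + 'k)" where
  "lifted_model A B b \<phi> x u =
     A *v lift \<phi> x + from_columns b *v u + (\<Sum>i\<in>UNIV. (B i - A) *v (u $ i *\<^sub>R lift \<phi> x))"

definition predictor ::
  "real^('n + 'k::finite)^('n + 'k) \<Rightarrow> ('m::finite \<Rightarrow> real^('n + 'k)^('n + 'k)) \<Rightarrow> ('m \<Rightarrow> real^('n + 'k)) \<Rightarrow>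
   ('k \<Rightarrow> real^'n \<Rightarrow> real) \<Rightarrow> real^'n \<Rightarrow> real^'m \<Rightarrow> real^'n" where
  "predictor A B b \<phi> x u = hcat (mat 1) 0 *v lifted_model A B b \<phi> x u"

definition error_matrix ::
  "real \<Rightarrow> real \<Rightarrow> ('k::finite \<Rightarrow> real^'n \<Rightarrow> real) \<Rightarrow> real^'n \<Rightarrow> real^'m \<Rightarrow>
   real^((('n + 'k) \<times> 'n) + ('m \<times> 'n))^'n" where
  "error_matrix cx cu \<phi> x u =
     hcat (cx *\<^sub>R kron_row (lift \<phi> x) (mat 1)) (cu *\<^sub>R kron_row u (mat 1))"

definition disturbance_set :: "(real^(('z::finite \<times> 'n::finite) + ('m::finite \<times> 'n))) set" where
  "disturbance_set = {vstack (kron_vec w\<Phi> wx) (kron_vec wu wx) | w\<Phi> wu wx.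
     w\<Phi> \<in> cball 0 1 \<and> wu \<in> cball 0 1 \<and> wx \<in> cball 0 1}"

definition uncertain_predictor ::
  "real^('n + 'k::finite)^('n + 'k) \<Rightarrow> ('m::finite \<Rightarrow> real^('n + 'k)^('n + 'k)) \<Rightarrow> ('m \<Rightarrow> real^('n + 'k)) \<Rightarrow>
   ('k \<Rightarrow> real^'n \<Rightarrow> real) \<Rightarrow> real \<Rightarrow> real \<Rightarrow>
   real^'n \<Rightarrow> real^'m \<Rightarrow> real^((('n + 'k) \<times> 'n) + ('m \<times> 'n)) \<Rightarrow> real^'n" where
  "uncertain_predictor A B b \<phi> cx cu x u w =
     predictor A B b \<phi> x u + error_matrix cx cu \<phi> x u *v w"

definition closed_loop_jacobian ::
  "(real^'n \<Rightarrow> real^'m \<Rightarrow> 'w \<Rightarrow> real^'n) \<Rightarrow> (real^'n \<Rightarrow> real^'n^'m) \<Rightarrow>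
   real^'n \<Rightarrow> real^'m \<Rightarrow> 'w \<Rightarrow> real^'n^'n" where
  "closed_loop_jacobian fw K x u w =
     jacobian (\<lambda>x'. fw x' u w) (at x) + jacobian (\<lambda>u'. fw x u' w) (at u) ** K x"

definition rccm ::
  "((real^'n) \<times> (real^'m)) set \<Rightarrow> 'w set \<Rightarrow> (real^'n \<Rightarrow> real^'m \<Rightarrow> 'w \<Rightarrow> real^'n) \<Rightarrow>
   (real^'n \<Rightarrow> real^'n^'n) \<Rightarrow> (real^'n \<Rightarrow> real^'n^'m) \<Rightarrow> real \<Rightarrow> real \<Rightarrow> real \<Rightarrow> bool" where
  "rccm Z D fw M K \<rho> \<alpha>1 \<alpha>2 \<longleftrightarrow>
     (\<forall>x. M x \<in> spd) \<and> cont_diff M \<and> continuous_on UNIV K \<and>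
     0 < \<rho> \<and> \<rho> < 1 \<and> 0 < \<alpha>1 \<and> 0 < \<alpha>2 \<and>
     (\<forall>(x, u)\<in>Z. \<forall>w\<in>D.
        transpose (closed_loop_jacobian fw K x u w) ** M (fw x u w) ** closed_loop_jacobian fw K x u w
          \<preceq>\<^sub>L (1 - \<rho>) *\<^sub>R M x \<and>
        \<alpha>1 *\<^sub>R mat 1 \<preceq>\<^sub>L M x \<and> M x \<preceq>\<^sub>L \<alpha>2 *\<^sub>R mat 1 \<and>
        M (fw x u w) \<preceq>\<^sub>L \<alpha>2 *\<^sub>R mat 1)"

definition tightening ::
  "((real^'n::{finite,linorder}) \<times> (real^'m)) set \<Rightarrow> (real^'n::_ \<Rightarrow> real^'n::_^'n::_) \<Rightarrow> (real^'n::_ \<Rightarrow> real^'n::_^'m) \<Rightarrow>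
   ((real^'n::_) \<times> (real^'m) \<Rightarrow> real) \<Rightarrow> real" where
  "tightening Z M K hj =
     (GREATEST r. r \<in> (\<lambda>(x, u). norm ((row_deriv (\<lambda>x'. hj (x', u)) x + row_deriv (\<lambda>u'. hj (x, u')) u v* K x)
                                       v* matrix_inv (cholesky (M x)))) ` Z)"

definition stage_cost ::
  "real^'n^'n \<Rightarrow> real^'m^'m \<Rightarrow> real \<Rightarrow> real^'n \<Rightarrow> real^'m \<Rightarrow> real \<Rightarrow> real" where
  "stage_cost Q R lam x u \<delta> = (wnorm Q x)\<^sup>2 + (wnorm R u)\<^sup>2 + lam * \<delta>\<^sup>2"

definition terminal_control :: "real^'n \<Rightarrow> real^'m" where
  "terminal_control x = 0"

definition terminal_cost :: "real \<Rightarrow> real \<Rightarrow> real^'n \<Rightarrow> real \<Rightarrow> real" where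
  "terminal_cost lam \<rho> x \<delta> = lam / \<rho> * \<delta>\<^sup>2"

definition terminal_set ::
  "nat \<Rightarrow> (nat \<Rightarrow> (real^'n) \<times> (real^'m) \<Rightarrow> real) \<Rightarrow> (nat \<Rightarrow> real) \<Rightarrow> ((real^'n) \<times> real) set" where
  "terminal_set nh h c =
     {(x, \<delta>). 0 \<le> \<delta> \<and> x = 0 \<and> (\<forall>j\<in>{1..nh}. h j (x, terminal_control x) + c j * \<delta> \<le> 0)}"

end

theory Submission
  imports Defs
begin

text \<open>At the origin with zero input the lifted state vanishes, so the predicted state stays at the
  origin and the tube size \<open>\<delta>\<close> shrinks by the factor \<open>sqrt (1 - \<rho>)\<close>. Hence the cost condition holds
  with equality, and the constraints are preserved as soon as \<open>0 \<le> c j\<close>. The latter requires that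
  the maximum defining \<open>c j\<close> is attained on the compact set \<open>Z\<close>. The Cholesky factor enters it only
  through \<open>(norm (v P\<^sup>-\<^sup>1\<^sup>/\<^sup>2))\<^sup>2 = v P\<^sup>-\<^sup>1 v\<^sup>T\<close>, which is continuous in \<open>P\<close> by Cramer's rule.\<close>

section \<open>Existence of the Cholesky factor\<close>

text \<open>The smallest index is eliminated first; the remaining indices carry the Schur complement.\<close>

lemma cholesky_factor_exists_on:
  fixes P :: "'n::linorder \<Rightarrow> 'n \<Rightarrow> real"
  assumes "finite S"
    and "\<And>i j. i \<in> S \<Longrightarrow> j \<in> S \<Longrightarrow> P i j = P j i"
    and "\<And>v. \<exists>i\<in>S. v i \<noteq> 0 \<Longrightarrow> 0 < (\<Sum>i\<in>S. \<Sum>j\<in>S. v i * P i j * v j)"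
  shows "\<exists>U. (\<forall>i\<in>S. \<forall>j\<in>S. j < i \<longrightarrow> U i j = 0) \<and> (\<forall>i\<in>S. 0 < U i i) \<and>
             (\<forall>i\<in>S. \<forall>j\<in>S. P i j = (\<Sum>k\<in>S. U k i * U k j))"
  using assms
proof (induction S arbitrary: P rule: finite_linorder_min_induct)
  case empty
  then show ?case by auto
next
  case (insert m S)
  have mS: "m \<notin> S" using insert.hyps by auto
  have sym: "P i j = P j i" if "i \<in> insert m S" "j \<in> insert m S" for i j
    using insert.prems(1) that by blast
  \<comment> \<open>By symmetry the row and the column of \<open>m\<close> contribute equally, so
    the form is a quadratic polynomial in \<open>v m\<close>, ready for completing the
    square.\<close>
  have expand: "(\<Sum>i\<in>insert m S. \<Sum>j\<in>insert m S. v i * P i j * v j) =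
      v m * P m m * v m + 2 * v m * (\<Sum>j\<in>S. P m j * v j) + (\<Sum>i\<in>S. \<Sum>j\<in>S. v i * P i j * v j)"
    for v
  proof -
    have "(\<Sum>i\<in>S. v i * P i m * v m) = v m * (\<Sum>j\<in>S. P m j * v j)"
      unfolding sum_distrib_left by (rule sum.cong) (auto simp: sym)
    moreover have "(\<Sum>j\<in>S. v m * P m j * v j) = v m * (\<Sum>j\<in>S. P m j * v j)"
      by (simp add: sum_distrib_left mult.assoc)
    ultimately show ?thesis
      using mS insert.hyps(1) by (simp add: sum.distrib)
  qed
  define p where "p = P m m"
  have p: "0 < p"
  proof -
    \<comment> \<open>The indicator of \<open>m\<close> as test vector isolates the pivot.\<close>
    have "0 < (\<Sum>i\<in>insert m S. \<Sum>j\<in>insert m S. (if i = m then 1 else 0) * P i j * (if j = m then 1 else 0))"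
      by (rule insert.prems(2)) auto
    also have "\<dots> = P m m"
    proof -
      have "(if i = m then 1 else 0) = (0::real)" if "i \<in> S" for i using that mS by auto
      then show ?thesis unfolding expand by simp
    qed
    finally show ?thesis by (simp add: p_def)
  qed
  define P' where "P' i j = P i j - P m i * P m j / p" for i j
  have "\<exists>U. (\<forall>i\<in>S. \<forall>j\<in>S. j < i \<longrightarrow> U i j = 0) \<and> (\<forall>i\<in>S. 0 < U i i) \<and>
             (\<forall>i\<in>S. \<forall>j\<in>S. P' i j = (\<Sum>k\<in>S. U k i * U k j))"
  proof (rule insert.IH)
    show "P' i j = P' j i" if "i \<in> S" "j \<in> S" for i j
      using sym[of i j] that by (simp add: P'_def mult.commute)
  next
    fix v :: "'n \<Rightarrow> real"
    assume nz: "\<exists>i\<in>S. v i \<noteq> 0"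
    define s where "s = (\<Sum>j\<in>S. P m j * v j)"
    \<comment> \<open>The value \<open>- s / p\<close> minimizes the form in coordinate
      \<open>m\<close>; the minimum is the form of \<open>P'\<close> at \<open>v\<close>.\<close>
    define w where "w = v(m := - s / p)"
    have wv: "w i = v i" if "i \<in> S" for i using that mS by (auto simp: w_def)
    have "0 < (\<Sum>i\<in>insert m S. \<Sum>j\<in>insert m S. w i * P i j * w j)"
      by (rule insert.prems(2)) (use nz wv in force)
    also have "\<dots> = (\<Sum>i\<in>S. \<Sum>j\<in>S. v i * P i j * v j) - s * s / p"
      using p unfolding expand by (simp add: wv flip: s_def p_def) (simp add: w_def field_simps)
    also have "s * s / p = (\<Sum>i\<in>S. \<Sum>j\<in>S. v i * (P m i * P m j / p) * v j)"
      unfolding s_def sum_product sum_divide_distrib by (intro sum.cong) auto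
    also have "(\<Sum>i\<in>S. \<Sum>j\<in>S. v i * P i j * v j) - \<dots> = (\<Sum>i\<in>S. \<Sum>j\<in>S. v i * P' i j * v j)"
      by (simp add: P'_def algebra_simps flip: sum_subtractf)
    finally show "0 < (\<Sum>i\<in>S. \<Sum>j\<in>S. v i * P' i j * v j)" .
  qed
  then obtain V where V: "\<And>i j. i \<in> S \<Longrightarrow> j \<in> S \<Longrightarrow> j < i \<Longrightarrow> V i j = 0"
    "\<And>i. i \<in> S \<Longrightarrow> 0 < V i i"
    "\<And>i j. i \<in> S \<Longrightarrow> j \<in> S \<Longrightarrow> P' i j = (\<Sum>k\<in>S. V k i * V k j)"
    by blast
  \<comment> \<open>Products of the entries of row \<open>m\<close> restore the term
    \<open>P m i * P m j / p\<close> that was subtracted in \<open>P'\<close>; the zeros below the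
    pivot keep the rows of \<open>V\<close> from disturbing row and column \<open>m\<close> of
    \<open>P\<close>.\<close>
  define U where "U i j = (if i = m then P m j / sqrt p else if j = m then 0 else V i j)" for i j
  have Vm: "(\<Sum>k\<in>S. U k i * U k j) = (if i = m \<or> j = m then 0 else \<Sum>k\<in>S. V k i * V k j)" for i j
    using mS by (auto simp: U_def intro!: sum.neutral sum.cong)
  have "P i j = (\<Sum>k\<in>insert m S. U k i * U k j)"
    if "i \<in> insert m S" "j \<in> insert m S" for i j
  proof -
    have "(\<Sum>k\<in>insert m S. U k i * U k j) = P m i * P m j / p + (\<Sum>k\<in>S. U k i * U k j)"
      using mS insert.hyps(1) p by (simp add: U_def)
    also have "\<dots> = P i j"
      using that p V(3)[of i j] sym[of i j] mS by (auto simp: Vm P'_def p_def)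
    finally show ?thesis ..
  qed
  moreover have "\<forall>i\<in>insert m S. \<forall>j\<in>insert m S. j < i \<longrightarrow> U i j = 0"
    using V(1) insert.hyps(2) by (auto simp: U_def)
  moreover have "\<forall>i\<in>insert m S. 0 < U i i"
    using V(2) p mS by (auto simp: U_def simp flip: p_def)
  ultimately show ?case by blast
qed

text \<open>Elimination over all indices supplies a witness, so the choice in
  \<open>cholesky\<close> meets its specification.\<close>

lemma cholesky_factorization:
  fixes P :: "real^'n::{finite,linorder}^'n::_"
  assumes "P \<in> spd"
  shows "P = transpose (cholesky P) ** cholesky P"
proof -
  have "\<exists>U. (\<forall>i\<in>UNIV. \<forall>j\<in>UNIV. j < i \<longrightarrow> U i j = 0) \<and> (\<forall>i\<in>UNIV. 0 < U i i) \<and>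
          (\<forall>i\<in>UNIV. \<forall>j\<in>UNIV. P $ i $ j = (\<Sum>k\<in>UNIV. U k i * U k j))"
  proof (rule cholesky_factor_exists_on)
    show "P $ i $ j = P $ j $ i" for i j
      using assms by (simp add: spd_def transpose_def vec_eq_iff)
    fix v :: "'n \<Rightarrow> real"
    assume "\<exists>i\<in>UNIV. v i \<noteq> 0"
    then have "(\<chi> i. v i) \<noteq> 0" by (auto simp: vec_eq_iff)
    then have "0 < (\<chi> i. v i) \<bullet> (P *v (\<chi> i. v i))" using assms by (auto simp: spd_def)
    then show "0 < (\<Sum>i\<in>UNIV. \<Sum>j\<in>UNIV. v i * P $ i $ j * v j)"
      by (simp add: inner_vec_def matrix_vector_mult_def sum_distrib_left mult.assoc)
  qed simp
  then obtain U where U: "\<And>i j. j < i \<Longrightarrow> U i j = 0" "\<And>i. 0 < U i i"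
    "\<And>i j. P $ i $ j = (\<Sum>k\<in>UNIV. U k i * U k j)"
    by auto
  have "\<exists>U. (\<forall>i j. j < i \<longrightarrow> U $ i $ j = 0) \<and> (\<forall>i. 0 < U $ i $ i) \<and> P = transpose U ** U"
    by (rule exI[of _ "\<chi> i j. U i j"])
      (auto simp: U(1,2) U(3)[symmetric] vec_eq_iff matrix_matrix_mult_def transpose_def)
  from someI_ex[OF this] show ?thesis unfolding cholesky_def by blast
qed

section \<open>Inverse factors via Cramer's rule\<close>

lemma det_spd_nonzero:
  fixes P :: "real^'n^'n"
  assumes "P \<in> spd"
  shows "det P \<noteq> 0"
proof -
  have "x = 0" if "P *v x = 0" for x
    using assms that unfolding spd_def by (metis (mono_tags, lifting) inner_zero_right less_irrefl mem_Collect_eq)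
  then have "invertible P"
    using matrix_left_invertible_ker[of P] invertible_left_inverse by blast
  then show ?thesis by (simp add: invertible_det_nz)
qed

text \<open>For invertible \<open>P\<close> this is the solution \<open>y\<close> of
  \<open>P *v y = v\<close>. Writing each entry as a quotient of determinants exposes its continuity
  in \<open>P\<close> and \<open>v\<close>.\<close>

definition cramer_solution :: "real^'n^'n \<Rightarrow> real^'n \<Rightarrow> real^'n" where
  "cramer_solution P v = (\<chi> k. det (\<chi> i j. if j = k then v $ i else P $ i $ j) / det P)"

text \<open>With \<open>W\<close> the inverse of the factor, \<open>W ** transpose W\<close> inverts
  \<open>P\<close>; the squared norm is therefore a quadratic form in which the factor itself no
  longer occurs.\<close>

lemma norm_mult_inverse_cholesky:
  fixes P :: "real^'n::{finite,linorder}^'n::_"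
  assumes "P \<in> spd"
  shows "norm (v v* matrix_inv (cholesky P)) = sqrt (v \<bullet> cramer_solution P v)"
proof -
  define U where "U = cholesky P"
  define W where "W = matrix_inv U"
  have P: "P = transpose U ** U"
    using cholesky_factorization[OF assms] by (simp add: U_def)
  have nz: "det P \<noteq> 0" by (rule det_spd_nonzero[OF assms])
  then have "invertible U" by (auto simp: P det_mul invertible_det_nz)
  then have UW: "U ** W = mat 1" 
    unfolding W_def matrix_inv_def invertible_def by (metis (mono_tags, lifting) someI_ex)
  \<comment> \<open>A right inverse of a square matrix is also a left inverse; transposing that
    identity gives the claim.\<close>
  have WU: "transpose U ** transpose W = mat 1"
    by (metis UW matrix_left_right_inverse matrix_transpose_mul transpose_mat)
  define y where "y = W *v (transpose W *v v)"
  have "P *v y = v"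
  proof -
    have "P *v y = transpose U *v ((U ** W) *v (transpose W *v v))"
      by (simp add: P y_def matrix_vector_mul_assoc matrix_mul_assoc)
    also have "\<dots> = v" by (simp only: UW matrix_mul_lid matrix_vector_mul_lid matrix_vector_mul_assoc WU)
    finally show ?thesis .
  qed
  then have "y = cramer_solution P v"
    using cramer[OF nz] by (auto simp: cramer_solution_def)
  moreover have "v \<bullet> y = (v v* W) \<bullet> (v v* W)"
    by (simp add: y_def dot_lmul_matrix)
  ultimately show ?thesis by (simp add: norm_eq_sqrt_inner W_def U_def)
qed

text \<open>The determinant is a polynomial in the entries. Continuity is assumed entrywise because
  the matrices of Cramer's rule, with one column replaced, are given entry by entry.\<close>

lemma continuous_on_det [continuous_intros]:
  fixes F :: "'a::topological_space \<Rightarrow> real^'n^'n"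
  assumes "\<And>i j. continuous_on S (\<lambda>x. F x $ i $ j)"
  shows "continuous_on S (\<lambda>x. det (F x))"
  unfolding det_def by (intro continuous_intros assms)

lemma continuous_on_cramer_solution:
  fixes F :: "'a::topological_space \<Rightarrow> real^'n^'n"
  assumes F: "continuous_on S F" and v: "continuous_on S v"
    and "\<And>x. x \<in> S \<Longrightarrow> det (F x) \<noteq> 0"
  shows "continuous_on S (\<lambda>x. cramer_solution (F x) (v x))"
proof -
  have "continuous_on S (\<lambda>x. F x $ i $ j)" "continuous_on S (\<lambda>x. v x $ i)" for i j
    by (intro continuous_intros F v)+
  \<comment> \<open>The indices are fixed while \<open>x\<close> varies, so each entry stays in one
    branch of the conditional.\<close>
  then have "continuous_on S (\<lambda>x. (\<chi> i j. if j = k then v x $ i else F x $ i $ j) $ i $ j)" for i j k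
    by (cases "j = k") auto
  then show ?thesis
    unfolding cramer_solution_def
    using assms(3) by (intro continuous_intros) (auto intro: continuous_intros F)
qed

section \<open>Continuity of the constraint gradients and sign of the tightening constants\<close>

lemma cont_diff_imp_continuous_on: "cont_diff F \<Longrightarrow> continuous_on S F"
  unfolding cont_diff_def
  by (meson UNIV_I continuous_at_imp_continuous_on has_derivative_continuous)

text \<open>Partial derivatives are the total derivative evaluated on axis vectors padded with zero,
  so they inherit its joint continuity.\<close>

lemma continuous_on_row_deriv:
  fixes hj :: "(real^'n) \<times> (real^'m) \<Rightarrow> real"
  assumes "cont_diff hj"
  shows "continuous_on S (\<lambda>(x, u). row_deriv (\<lambda>x'. hj (x', u)) x)"
    and "continuous_on S (\<lambda>(x, u). row_deriv (\<lambda>u'. hj (x, u')) u)"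
proof -
  obtain h' where h': "\<And>z. (hj has_derivative blinfun_apply (h' z)) (at z)" "continuous_on UNIV h'"
    using assms unfolding cont_diff_def by blast
  have "((\<lambda>x'. hj (x', u)) has_derivative (\<lambda>d. blinfun_apply (h' (x, u)) (d, 0))) (at x)" for x u
    by (rule has_derivative_compose[OF _ h'(1)]) (auto intro!: derivative_eq_intros)
  \<comment> \<open>Uniqueness of derivatives replaces the chosen \<open>frechet_derivative\<close>
    by the explicit one.\<close>
  then have x: "row_deriv (\<lambda>x'. hj (x', u)) x = (\<chi> i. h' (x, u) (axis i 1, 0))" for x u
    unfolding row_deriv_def by (metis frechet_derivative_at)
  have "((\<lambda>u'. hj (x, u')) has_derivative (\<lambda>d. blinfun_apply (h' (x, u)) (0, d))) (at u)" for x u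
    by (rule has_derivative_compose[OF _ h'(1)]) (auto intro!: derivative_eq_intros)
  then have u: "row_deriv (\<lambda>u'. hj (x, u')) u = (\<chi> i. h' (x, u) (0, axis i 1))" for x u
    unfolding row_deriv_def by (metis frechet_derivative_at)
  have "continuous_on S h'" using h'(2) continuous_on_subset by blast
  then show "continuous_on S (\<lambda>(x, u). row_deriv (\<lambda>x'. hj (x', u)) x)"
    "continuous_on S (\<lambda>(x, u). row_deriv (\<lambda>u'. hj (x, u')) u)"
    unfolding x u by (auto simp: case_prod_unfold intro!: continuous_intros)
qed

lemma continuous_on_vector_matrix_mult:
  fixes F :: "'a::topological_space \<Rightarrow> real^'n^'m"
  assumes "continuous_on S v" "continuous_on S F"
  shows "continuous_on S (\<lambda>x. v x v* F x)"
  unfolding vector_matrix_mult_def by (intro continuous_intros assms)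

text \<open>\<open>GREATEST\<close> is unspecified unless the maximum is attained, whence the compactness assumption.\<close>

lemma tightening_nonneg:
  fixes Z :: "((real^'n::{finite,linorder}) \<times> (real^'m)) set"
  assumes "compact Z" "Z \<noteq> {}" "cont_diff hj" "continuous_on UNIV M" "continuous_on UNIV K"
    and spd: "\<And>x. M x \<in> spd"
  shows "0 \<le> tightening Z M K hj"
proof -
  define v where "v = (\<lambda>(x, u). row_deriv (\<lambda>x'. hj (x', u)) x + row_deriv (\<lambda>u'. hj (x, u')) u v* K x)"
  define F where "F = (\<lambda>z. norm (v z v* matrix_inv (cholesky (M (fst z)))))"
  have MK: "continuous_on Z (\<lambda>z. M (fst z))" "continuous_on Z (\<lambda>z. K (fst z))"
    using assms(4,5) by (auto intro!: continuous_on_compose2[OF _ continuous_on_fst[OF continuous_on_id]])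
  have v: "continuous_on Z v"
    using continuous_on_row_deriv[OF assms(3), of Z] unfolding v_def case_prod_unfold
    by (intro continuous_intros continuous_on_vector_matrix_mult MK)
  \<comment> \<open>\<open>cholesky\<close> and \<open>matrix_inv\<close> are defined by choice;
    continuity is read off after trading them for Cramer's formula.\<close>
  have "F = (\<lambda>z. sqrt (v z \<bullet> cramer_solution (M (fst z)) (v z)))"
    by (simp add: F_def norm_mult_inverse_cholesky[OF spd])
  then have "continuous_on Z F"
    by (auto intro!: continuous_intros continuous_on_cramer_solution MK v det_spd_nonzero spd)
  then obtain z where z: "z \<in> Z" "\<And>y. y \<in> Z \<Longrightarrow> F y \<le> F z"
    using continuous_attains_sup[OF assms(1,2)] by blast
  have "tightening Z M K hj = (GREATEST r. r \<in> F ` Z)"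
    by (simp add: tightening_def F_def v_def case_prod_unfold)
  \<comment> \<open>The attained maximum determines \<open>GREATEST\<close>, and it is a norm, hence
    nonnegative.\<close>
  also have "\<dots> = F z" using z by (intro Greatest_equality) auto
  finally show ?thesis by (simp add: F_def)
qed

section \<open>The model at the origin and the terminal conditions\<close>

lemma lift_zero:
  assumes "\<And>l. \<phi> l 0 = 0"
  shows "lift \<phi> 0 = 0"
  by (auto simp: lift_def vstack_def vec_eq_iff assms split: sum.split)

text \<open>The lifted model has no constant term: every summand has the lifted state or the input
  as a factor.\<close>

lemma predictor_zero:
  assumes "\<And>l. \<phi> l 0 = 0"
  shows "predictor A B b \<phi> 0 0 = 0"
  by (simp add: predictor_def lifted_model_def lift_zero assms)

theorem proposition3:
  fixes X :: "(real^'n::{finite,linorder}) set"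
    and U :: "(real^'m) set"
    and f :: "real^'n::_ \<Rightarrow> real^'n::_"
    and g :: "real^'n::_ \<Rightarrow> real^'m^'n::_"
    and Ts :: real
    and nh :: nat
    and h :: "nat \<Rightarrow> (real^'n::_) \<times> (real^'m) \<Rightarrow> real"
    and \<phi> :: "'k::finite \<Rightarrow> real^'n::_ \<Rightarrow> real"
    and xd yd :: "real^'m \<Rightarrow> 'd::finite \<Rightarrow> real^'n::_"
    and A :: "real^('n::_ + 'k)^('n::_ + 'k)"
    and B :: "'m \<Rightarrow> real^('n::_ + 'k)^('n::_ + 'k)"
    and b :: "'m \<Rightarrow> real^('n::_ + 'k)"
    and cx cu :: real
    and M :: "real^'n::_ \<Rightarrow> real^'n::_^'n::_"
    and K :: "real^'n::_ \<Rightarrow> real^'n::_^'m"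
    and \<rho> \<alpha>1 \<alpha>2 :: real
    and Q :: "real^'n::_^'n::_"
    and R :: "real^'m^'m"
    and lam :: real
    and c :: "nat \<Rightarrow> real"
  defines "Z \<equiv> constraint_set nh h"
    and "Xf \<equiv> terminal_set nh h c"
    and "kf \<equiv> (terminal_control :: real^'n::_ \<Rightarrow> real^'m)"
  assumes "compact X" and "compact U" and "\<And>i. axis i 1 \<in> U"
    and "f 0 = 0" and "0 < Ts"
    and "Z \<subseteq> X \<times> U" and "compact Z"
    and "\<And>j. j \<in> {1..nh} \<Longrightarrow> cont_diff (h j)"
    and "\<And>j. j \<in> {1..nh} \<Longrightarrow> h j (0, 0) < 0"
    and "\<And>l. cont_diff (\<phi> l)" and "\<And>l. \<phi> l 0 = 0"
    and data: "\<And>v j. v \<in> insert 0 (range (\<lambda>i. axis i 1)) \<Longrightarrow>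
                 flow_defined f g Ts (xd v j) v \<and> yd v j = flow f g Ts (xd v j) v"
    and fit_A: "least_squares_fit A
                 (from_columns (\<lambda>j. lift \<phi> (yd 0 j))) (from_columns (\<lambda>j. lift \<phi> (xd 0 j)))"
    and fit_B: "\<And>i. least_squares_fit (hcat (columnvector (b i)) (B i))
                 (from_columns (\<lambda>j. lift \<phi> (yd (axis i 1) j)))
                 (from_columns (\<lambda>j. lift1 \<phi> (xd (axis i 1) j)))"
    and "0 \<le> cx" and "0 \<le> cu"
    and error_bound: "\<And>x u. x \<in> X \<Longrightarrow> u \<in> U \<Longrightarrow> flow_defined f g Ts x u \<Longrightarrow>
          norm (lift \<phi> (flow f g Ts x u) - lifted_model A B b \<phi> x u) \<le> cx * norm (lift \<phi> x) + cu * norm u"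
    and rccm: "rccm Z disturbance_set (uncertain_predictor A B b \<phi> cx cu) M K \<rho> \<alpha>1 \<alpha>2"
    and "Q \<in> spd" and "R \<in> spd" and "0 < lam"
    and c: "\<And>j. j \<in> {1..nh} \<Longrightarrow> c j = tightening Z M K (h j)"
  shows "\<forall>x \<delta>. (x, \<delta>) \<in> Xf \<longrightarrow>
    (let x' = predictor A B b \<phi> x (kf x);
         \<delta>' = sqrt (1 - \<rho>) * \<delta> + sqrt \<alpha>2 * (cx * norm (lift \<phi> x) + cu * norm (kf x))
     in (x', \<delta>') \<in> Xf
      \<and> (\<forall>j\<in>{1..nh}. h j (x, kf x) + c j * \<delta> \<le> 0 \<and> h j (x', kf x') + c j * \<delta>' \<le> 0)
      \<and> stage_cost Q R lam x (kf x) \<delta> \<le> terminal_cost lam \<rho> x \<delta> - terminal_cost lam \<rho> x' \<delta>'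
      \<and> (\<forall>\<delta>''\<in>{0..\<delta>}. (x, \<delta>'') \<in> Xf \<and> terminal_cost lam \<rho> x \<delta>'' \<le> terminal_cost lam \<rho> x \<delta>))"
proof (intro allI impI)
  fix x \<delta>
  assume xd: "(x, \<delta>) \<in> Xf"
  then have x: "x = 0" and \<delta>: "0 \<le> \<delta>"
    and h\<delta>: "\<And>j. j \<in> {1..nh} \<Longrightarrow> h j (0, 0) + c j * \<delta> \<le> 0"
    by (auto simp: Xf_def terminal_set_def terminal_control_def)
  have \<rho>: "0 < \<rho>" "\<rho> < 1" using rccm by (auto simp: rccm_def)
  \<comment> \<open>The origin makes \<open>Z\<close> nonempty, so that the maximum behind
    \<open>c j\<close> exists.\<close>
  have "(0, 0) \<in> Z"
    using \<open>\<And>j. j \<in> {1..nh} \<Longrightarrow> h j (0, 0) < 0\<close> by (auto simp: Z_def constraint_set_def less_imp_le)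
  then have c0: "0 \<le> c j" if "j \<in> {1..nh}" for j
    using rccm \<open>compact Z\<close> that \<open>\<And>j. j \<in> {1..nh} \<Longrightarrow> cont_diff (h j)\<close> unfolding c[OF that]
    by (intro tightening_nonneg) (auto simp: rccm_def cont_diff_imp_continuous_on)
  \<comment> \<open>Since \<open>0 \<le> c j\<close>, shrinking the tube only relaxes the
    constraints. This serves both the successor \<open>\<delta>'\<close> and the final monotonicity
    claim.\<close>
  have smaller: "(0, d) \<in> Xf" if "0 \<le> d" "d \<le> \<delta>" for d
    using that h\<delta> c0 by (fastforce simp: Xf_def terminal_set_def terminal_control_def
        dest: mult_left_mono[OF \<open>d \<le> \<delta>\<close>])
  have x': "predictor A B b \<phi> x (kf x) = 0"
    by (simp add: x kf_def terminal_control_def predictor_zero \<open>\<And>l. \<phi> l 0 = 0\<close>)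
  define \<delta>' where "\<delta>' = sqrt (1 - \<rho>) * \<delta>"
  have \<delta>'_eq: "sqrt (1 - \<rho>) * \<delta> + sqrt \<alpha>2 * (cx * norm (lift \<phi> x) + cu * norm (kf x)) = \<delta>'"
    by (simp add: x kf_def terminal_control_def lift_zero \<open>\<And>l. \<phi> l 0 = 0\<close> \<delta>'_def)
  have \<delta>': "0 \<le> \<delta>'" "\<delta>' \<le> \<delta>"
    using \<rho> \<delta> by (auto simp: \<delta>'_def mult_left_le_one_le)
  have in': "(0, \<delta>') \<in> Xf" using smaller \<delta>' .
  have "\<forall>j\<in>{1..nh}. h j (x, kf x) + c j * \<delta> \<le> 0 \<and> h j (0, kf 0) + c j * \<delta>' \<le> 0"
    using xd in' by (auto simp: Xf_def kf_def terminal_set_def)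
  \<comment> \<open>The weight \<open>lam / \<rho>\<close> sums the geometric series of the costs
    \<open>lam * (1 - \<rho>)^k\<close>: one step lowers the terminal cost by
    \<open>lam / \<rho> * (1 - (1 - \<rho>)) * \<delta>\<^sup>2\<close>, exactly the stage
    cost.\<close>
  moreover have "stage_cost Q R lam x (kf x) \<delta> \<le> terminal_cost lam \<rho> x \<delta> - terminal_cost lam \<rho> 0 \<delta>'"
    using \<rho> by (simp add: stage_cost_def terminal_cost_def wnorm_def x kf_def terminal_control_def
        \<delta>'_def power_mult_distrib field_simps)
  moreover have "\<forall>\<delta>''\<in>{0..\<delta>}. (x, \<delta>'') \<in> Xf \<and> terminal_cost lam \<rho> x \<delta>'' \<le> terminal_cost lam \<rho> x \<delta>"
    using \<rho> \<open>0 < lam\<close>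
    by (auto simp: x smaller terminal_cost_def intro!: mult_left_mono divide_right_mono power_mono)
  ultimately show "let x' = predictor A B b \<phi> x (kf x);
         \<delta>' = sqrt (1 - \<rho>) * \<delta> + sqrt \<alpha>2 * (cx * norm (lift \<phi> x) + cu * norm (kf x))
     in (x', \<delta>') \<in> Xf
      \<and> (\<forall>j\<in>{1..nh}. h j (x, kf x) + c j * \<delta> \<le> 0 \<and> h j (x', kf x') + c j * \<delta>' \<le> 0)
      \<and> stage_cost Q R lam x (kf x) \<delta> \<le> terminal_cost lam \<rho> x \<delta> - terminal_cost lam \<rho> x' \<delta>'
      \<and> (\<forall>\<delta>''\<in>{0..\<delta>}. (x, \<delta>'') \<in> Xf \<and> terminal_cost lam \<rho> x \<delta>'' \<le> terminal_cost lam \<rho> x \<delta>)"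
    unfolding Let_def x' \<delta>'_eq using in' by blast
qed

end
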